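(* Let $n\in\mathbb{N}$, let $a<b$ be real numbers, let $\alpha_n:[a,b]^2\to(n-1,n)$ be continuous, and let $x,y\in C^n([a,b],\mathbb{R})$. Then $$ \int_{a}^{b}y(t)\,{}^C_aD_t^{\alpha_n(\cdot,\cdot)} x(t)\,dt =\int_a^b x(t)\,{}_tD_b^{\alpha_n(\cdot,\cdot)}y(t)\,dt+\left[\sum_{k=0}^{n-1} (-1)^{k} x^{(n-1-k)}(t)\, \frac{d^{k}}{dt^{k}}\,{}_tI_b^{n-\alpha_n(\cdot,\cdot)}y(t) \right]_{t=a}^{t=b} $$ and $$ \int_{a}^{b}y(t)\,{}^C_tD_b^{\alpha_n(\cdot,\cdot)}x(t)\,dt=\int_a^b x(t)\,{}_aD_t^{\alpha_n(\cdot,\cdot)} y(t)\,dt +\left[\sum_{k=0}^{n-1} (-1)^{n+k}x^{(n-1-k)}(t)\, \frac{d^{k}}{dt^{k}}\,{}_aI_t^{n-\alpha_n(\cdot,\cdot)}y(t)\right]_{t=a}^{t=b}. $$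
   Context: Let $n\in\mathbb{N}$ and let $\alpha_n:[a,b]^2\to(n-1,n)$ be a continuous function of two variables (the variable fractional order). $\Gamma$ is the Gamma function. Left and right Riemann--Liouville fractional integrals of order $n-\alpha_n(\cdot,\cdot)$: $$ {}_aI_t^{n-\alpha_n(\cdot,\cdot)} y(t)=\int_a^t \frac{(t-\tau)^{n-1-\alpha_n(t,\tau)}}{\Gamma(n-\alpha_n(t,\tau))}\,y(\tau)\,d\tau,\qquad {}_tI_b^{n-\alpha_n(\cdot,\cdot)} y(t)=\int_t^b \frac{(\tau-t)^{n-1-\alpha_n(\tau,t)}}{\Gamma(n-\alpha_n(\tau,t))}\,y(\tau)\,d\tau . $$ Left and right Riemann--Liouville fractional derivatives of order $\alpha_n(\cdot,\cdot)$: $$ {}_aD_t^{\alpha_n(\cdot,\cdot)} y(t)=\frac{d^n}{dt^n}\,{}_aI_t^{n-\alpha_n(\cdot,\cdot)} y(t),\qquad {}_tD_b^{\alpha_n(\cdot,\cdot)} y(t)=(-1)^n\frac{d^n}{dt^n}\,{}_tI_b^{n-\alpha_n(\cdot,\cdot)} y(t). $$ Left and right Caputo fractional derivatives of order $\alpha_n(\cdot,\cdot)$: $$ {}^C_aD_t^{\alpha_n(\cdot,\cdot)} x(t)=\int_a^t\frac{(t-\tau)^{n-1-\alpha_n(t,\tau)}}{\Gamma(n-\alpha_n(t,\tau))}\,x^{(n)}(\tau)\,d\tau,\qquad {}^C_tD_b^{\alpha_n(\cdot,\cdot)} x(t)=(-1)^{n}\int_t^b\frac{(\tau-t)^{n-1-\alpha_n(\tau,t)}}{\Gamma(n-\alpha_n(\tau,t))}\,x^{(n)}(\tau)\,d\tau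 . $$ The notation $[F(t)]_{t=a}^{t=b}$ means $F(b)-F(a)$.
   Formalization: Each formula is asserted when its right-hand side exists: derivatives of the fractional integral of y of order below n on [a,b], of order n on (a,b), and the integral of x times the fractional derivative of y; for n=2, constant order, x=y=1 these fail. *)

theory Defs
  imports "HOL-Analysis.Analysis"
begin

text \<open>Derivatives are taken within the set \<open>S\<close>; for \<open>S = {a..b}\<close> they are one-sided at \<open>a\<close> and \<open>b\<close>,
  so they do not depend on values of \<open>f\<close> outside of \<open>{a..b}\<close>.\<close>

definition nderiv_on :: "real set \<Rightarrow> nat \<Rightarrow> (real \<Rightarrow> real) \<Rightarrow> real \<Rightarrow> real" where
  "nderiv_on S k f = ((\<lambda>g t. vector_derivative g (at t within S)) ^^ k) f"

definition n_times_differentiable_on :: "nat \<Rightarrow> (real \<Rightarrow> real) \<Rightarrow> real set \<Rightarrow> real set \<Rightarrow> bool" where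
  \<comment> \<open>differentiable \<open>k\<close> times at the points of \<open>T \<subseteq> S\<close>, with derivatives taken within \<open>S\<close>\<close>
  "n_times_differentiable_on k f S T \<longleftrightarrow> (\<forall>j<k. \<forall>t\<in>T. nderiv_on S j f differentiable (at t within S))"

definition C_n_on :: "nat \<Rightarrow> (real \<Rightarrow> real) \<Rightarrow> real set \<Rightarrow> bool" where
  "C_n_on n f S \<longleftrightarrow> n_times_differentiable_on n f S S \<and> continuous_on S (nderiv_on S n f)"

text \<open>The kernel is written with its arguments in the
  order in which they enter \<open>\<alpha>\<close>: it is used for \<open>s \<ge> r\<close>, and the right-sided operators use
  \<open>frac_kernel n \<alpha> \<tau> t\<close> with the variables exchanged. At \<open>s = r\<close> its value is \<open>0\<close>, since
  \<open>0 powr z = 0\<close>, which is irrelevant for the integrals.\<close>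

definition frac_kernel :: "nat \<Rightarrow> (real \<Rightarrow> real \<Rightarrow> real) \<Rightarrow> real \<Rightarrow> real \<Rightarrow> real" where
  "frac_kernel n \<alpha> s r = (s - r) powr (real n - 1 - \<alpha> s r) / Gamma (real n - \<alpha> s r)"

definition RL_int_left :: "real \<Rightarrow> nat \<Rightarrow> (real \<Rightarrow> real \<Rightarrow> real) \<Rightarrow> (real \<Rightarrow> real) \<Rightarrow> real \<Rightarrow> real" where
  "RL_int_left a n \<alpha> y t = integral {a..t} (\<lambda>\<tau>. frac_kernel n \<alpha> t \<tau> * y \<tau>)"

definition RL_int_right :: "real \<Rightarrow> nat \<Rightarrow> (real \<Rightarrow> real \<Rightarrow> real) \<Rightarrow> (real \<Rightarrow> real) \<Rightarrow> real \<Rightarrow> real" where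
  "RL_int_right b n \<alpha> y t = integral {t..b} (\<lambda>\<tau>. frac_kernel n \<alpha> \<tau> t * y \<tau>)"

definition RL_deriv_left ::
  "real \<Rightarrow> real \<Rightarrow> nat \<Rightarrow> (real \<Rightarrow> real \<Rightarrow> real) \<Rightarrow> (real \<Rightarrow> real) \<Rightarrow> real \<Rightarrow> real" where
  "RL_deriv_left a b n \<alpha> y t = nderiv_on {a..b} n (RL_int_left a n \<alpha> y) t"

definition RL_deriv_right ::
  "real \<Rightarrow> real \<Rightarrow> nat \<Rightarrow> (real \<Rightarrow> real \<Rightarrow> real) \<Rightarrow> (real \<Rightarrow> real) \<Rightarrow> real \<Rightarrow> real" where
  "RL_deriv_right a b n \<alpha> y t = (-1) ^ n * nderiv_on {a..b} n (RL_int_right b n \<alpha> y) t"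

definition Caputo_deriv_left ::
  "real \<Rightarrow> real \<Rightarrow> nat \<Rightarrow> (real \<Rightarrow> real \<Rightarrow> real) \<Rightarrow> (real \<Rightarrow> real) \<Rightarrow> real \<Rightarrow> real" where
  "Caputo_deriv_left a b n \<alpha> x t =
     integral {a..t} (\<lambda>\<tau>. frac_kernel n \<alpha> t \<tau> * nderiv_on {a..b} n x \<tau>)"

definition Caputo_deriv_right ::
  "real \<Rightarrow> real \<Rightarrow> nat \<Rightarrow> (real \<Rightarrow> real \<Rightarrow> real) \<Rightarrow> (real \<Rightarrow> real) \<Rightarrow> real \<Rightarrow> real" where
  "Caputo_deriv_right a b n \<alpha> x t =
     (-1) ^ n * integral {t..b} (\<lambda>\<tau>. frac_kernel n \<alpha> \<tau> t * nderiv_on {a..b} n x \<tau>)"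

text \<open>For \<open>y\<close> of class \<open>C\<^sup>n\<close> and \<open>\<alpha>\<close> merely continuous, the fractional integral \<open>g\<close> of \<open>y\<close> need not
  be \<open>n\<close> times differentiable; and for constant \<open>\<alpha>\<close> and \<open>n \<ge> 2\<close>, the boundary term \<open>g'\<close> is infinite
  at the base point of \<open>g\<close> unless \<open>y\<close> vanishes there. The formula therefore presupposes that the
  terms with \<open>g\<close> exist, and the following says just that: the derivatives of order below \<open>n\<close> exist up to the
  endpoints (boundary terms), the one of order \<open>n\<close> exists at the interior points (fractional
  derivative, which even for \<open>n = 1\<close> is usually infinite at an endpoint), and so does the
  integral of \<open>x\<close> times the latter.\<close>

definition by_parts_defined ::
  "real \<Rightarrow> real \<Rightarrow> nat \<Rightarrow> (real \<Rightarrow> real) \<Rightarrow> (real \<Rightarrow> real) \<Rightarrow> bool" where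
  "by_parts_defined a b n x g \<longleftrightarrow>
     n_times_differentiable_on (n - 1) g {a..b} {a..b} \<and>
     n_times_differentiable_on n g {a..b} {a<..<b} \<and>
     (\<lambda>t. x t * nderiv_on {a..b} n g t) integrable_on {a..b}"

end

theory Submission
  imports Defs
begin

text \<open>Fubini's theorem for the weakly singular kernel turns the left-hand side into the integral of
  \<open>x\<^sup>(\<^sup>n\<^sup>) g\<close>, where \<open>g\<close> is the opposite fractional integral of \<open>y\<close>, and \<open>n\<close> integrations by parts
  give the result. Only the last of these is delicate for \<open>n \<ge> 2\<close>: \<open>h' = g\<^sup>(\<^sup>n\<^sup>-\<^sup>1\<^sup>)\<close> is not assumed to be
  continuous at the endpoints. There \<open>(x h)'\<close> agrees in the interior with a continuous function,
  namely \<open>x' h\<close> plus a primitive of \<open>x' h' + x h''\<close>, and hence also at the endpoints,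
  where \<open>h\<close> is still differentiable from one side. For \<open>n = 1\<close>, \<open>g\<close> itself is continuous by
  dominated convergence.\<close>

section \<open>Integration by parts of order n with limited regularity at the endpoints\<close>

lemma product_has_integral_one_sided_endpoints:
  fixes h h1 h2 x x1 :: "real \<Rightarrow> real"
  assumes "a < b"
    and h: "\<And>t. t \<in> {a..b} \<Longrightarrow> (h has_vector_derivative h1 t) (at t within {a..b})"
    and h1: "\<And>t. t \<in> {a<..<b} \<Longrightarrow> (h1 has_vector_derivative h2 t) (at t)"
    and x: "\<And>t. t \<in> {a..b} \<Longrightarrow> (x has_vector_derivative x1 t) (at t within {a..b})"
    and x1: "continuous_on {a..b} x1"
    and int: "(\<lambda>t. x1 t * h1 t + x t * h2 t) integrable_on {a..b}"
  shows "((\<lambda>t. x1 t * h1 t + x t * h2 t) has_integral (x b * h1 b - x a * h1 a)) {a..b}"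
proof -
  define p where "p = (\<lambda>t. x1 t * h1 t + x t * h2 t)"
  define P where "P = (\<lambda>t. integral {a..t} p)"
  define m where "m = (a + b) / 2"
  \<comment> \<open>\<open>C\<close> is fitted so that \<open>x * h1 = P + C\<close> holds at the
    midpoint \<open>m\<close>. This makes \<open>R\<close> a continuous candidate for the derivative
    of \<open>x * h\<close>.\<close>
  define C where "C = x m * h1 m - P m"
  define R where "R = (\<lambda>t. x1 t * h t + (P t + C))"
  have m: "a < m" "m < b" using \<open>a < b\<close> by (auto simp: m_def)
  have conth: "continuous_on {a..b} h" and contx: "continuous_on {a..b} x"
    using h x by (blast intro: continuous_on_vector_derivative)+
  have contP: "continuous_on {a..b} P"
    unfolding P_def using int by (intro indefinite_integral_continuous_1) (simp add: p_def)
  have contR: "continuous_on {a..b} R"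
    unfolding R_def by (intro continuous_intros x1 conth contP)
  have h': "(h has_vector_derivative h1 t) (at t)" if "t \<in> {a<..<b}" for t
    using h[of t] that by (simp add: at_within_Icc_at)
  have x': "(x has_vector_derivative x1 t) (at t)" if "t \<in> {a<..<b}" for t
    using x[of t] that by (simp add: at_within_Icc_at)
  have step: "x d * h1 d - x c * h1 c = P d - P c" if cd: "a < c" "c \<le> d" "d < b" for c d
  proof -
    \<comment> \<open>The interval \<open>{c..d}\<close> stays away from both endpoints, so
      \<open>h1\<close> is differentiable on all of it and the fundamental theorem gives the
      increment of \<open>x * h1\<close>.\<close>
    have "(p has_integral (x d * h1 d - x c * h1 c)) {c..d}"
    proof (rule fundamental_theorem_of_calculus)
      fix t assume t: "t \<in> {c..d}"
      then have "((\<lambda>t. x t * h1 t) has_vector_derivative x t * h2 t + x1 t * h1 t) (at t)"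
        using cd by (intro has_vector_derivative_mult x' h1) auto
      then show "((\<lambda>t. x t * h1 t) has_vector_derivative p t) (at t within {c..d})"
        by (simp add: p_def add.commute has_vector_derivative_at_within)
    qed (use cd in auto)
    moreover have "integral {a..c} p + integral {c..d} p = integral {a..d} p"
      by (rule Henstock_Kurzweil_Integration.integral_combine)
        (use cd int in \<open>auto simp: p_def intro: integrable_subinterval_real\<close>)
    ultimately show ?thesis unfolding P_def by (simp add: has_integral_iff)
  qed
  have inner: "x t * h1 t = P t + C" if "t \<in> {a<..<b}" for t
    using step[of t m] step[of m t] that m by (cases "t \<le> m") (auto simp: C_def)
  \<comment> \<open>\<open>R\<close> is so far known to be the derivative of \<open>x * h\<close> in
    the interior only, but continuity of \<open>x * h\<close> up to the endpoints suffices to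
    integrate it from \<open>a\<close>.\<close>
  have xh: "(R has_integral (x t * h t - x a * h a)) {a..t}" if "t \<in> {a..b}" for t
  proof (rule fundamental_theorem_of_calculus_interior)
    show "continuous_on {a..t} (\<lambda>t. x t * h t)"
      using that by (intro continuous_intros continuous_on_subset[OF contx] continuous_on_subset[OF conth]) auto
    fix s assume s: "s \<in> {a<..<t}"
    then have "((\<lambda>t. x t * h t) has_vector_derivative x s * h1 s + x1 s * h s) (at s)"
      using that by (intro has_vector_derivative_mult x' h') auto
    then show "((\<lambda>t. x t * h t) has_vector_derivative R s) (at s)"
      using inner[of s] s that by (simp add: R_def add.commute)
  qed (use that in auto)
  have bdry: "x t * h1 t = P t + C" if t: "t \<in> {a..b}" for t
  proof -
    \<comment> \<open>An indefinite integral of the continuous \<open>R\<close> has derivative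
      \<open>R t\<close> at the endpoints too. The product rule computes the same one-sided
      derivative there, and uniqueness identifies the two values.\<close>
    have "((\<lambda>u. x a * h a + integral {a..u} R) has_vector_derivative 0 + R t) (at t within {a..b})"
      by (intro derivative_intros integral_has_vector_derivative contR t)
    then have "((\<lambda>t. x t * h t) has_vector_derivative 0 + R t) (at t within {a..b})"
      by (rule has_vector_derivative_transform[rotated 2, OF _ t]) (use xh in \<open>auto simp: has_integral_iff\<close>)
    moreover have "((\<lambda>t. x t * h t) has_vector_derivative x t * h1 t + x1 t * h t) (at t within {a..b})"
      by (intro has_vector_derivative_mult x h t)
    ultimately have "x t * h1 t + x1 t * h t = 0 + R t"
      using vector_derivative_unique_within_closed_interval[of a b t] \<open>a < b\<close> t by auto
    then show ?thesis by (simp add: R_def)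
  qed
  have "P a = 0" by (simp add: P_def)
  then have "x b * h1 b - x a * h1 a = integral {a..b} p"
    using bdry[of a] bdry[of b] \<open>a < b\<close> by (simp add: P_def)
  then show ?thesis using int by (simp add: p_def has_integral_iff)
qed

text \<open>The interior form of the fundamental theorem asks only for continuity at the endpoints.
  This is all that is known of \<open>G 0\<close> there when \<open>n = 1\<close>.\<close>

lemma product_has_integral_interior:
  fixes f g f' g' :: "real \<Rightarrow> real"
  assumes "a \<le> b" "continuous_on {a..b} f" "continuous_on {a..b} g"
    and "\<And>t. t \<in> {a<..<b} \<Longrightarrow> (f has_vector_derivative f' t) (at t)"
    and "\<And>t. t \<in> {a<..<b} \<Longrightarrow> (g has_vector_derivative g' t) (at t)"
  shows "((\<lambda>t. f' t * g t + f t * g' t) has_integral (f b * g b - f a * g a)) {a..b}"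
proof (rule fundamental_theorem_of_calculus_interior)
  show "continuous_on {a..b} (\<lambda>t. f t * g t)" using assms by (intro continuous_intros)
  show "((\<lambda>t. f t * g t) has_vector_derivative f' t * g t + f t * g' t) (at t)"
    if "t \<in> {a<..<b}" for t
    using has_vector_derivative_mult[OF assms(4,5)[OF that]] by (simp add: add.commute)
qed fact

text \<open>Each step moves one derivative from \<open>X\<close> to \<open>G\<close>. For
  \<open>m > 0\<close>, \<open>G m\<close> is a derivative that need not be continuous, so the
  integrability of the remaining integrand has to be carried through the induction.\<close>

lemma iterated_integration_by_parts:
  fixes X G :: "nat \<Rightarrow> real \<Rightarrow> real"
  assumes "a \<le> b" and m: "m \<le> n"
    and X: "\<And>j t. j < n \<Longrightarrow> t \<in> {a..b} \<Longrightarrow> (X j has_vector_derivative X (Suc j) t) (at t within {a..b})"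
    and Xn: "continuous_on {a..b} (X n)"
    and G: "\<And>j t. j < m \<Longrightarrow> t \<in> {a..b} \<Longrightarrow> (G j has_vector_derivative G (Suc j) t) (at t within {a..b})"
    and G0: "continuous_on {a..b} (G 0)"
  defines "F \<equiv> \<lambda>t. \<Sum>k<m. (-1) ^ k * X (n - 1 - k) t * G k t"
  shows "(\<lambda>t. X (n - m) t * G m t) integrable_on {a..b} \<and>
    integral {a..b} (\<lambda>t. X n t * G 0 t) =
      (-1) ^ m * integral {a..b} (\<lambda>t. X (n - m) t * G m t) + (F b - F a)"
  using m G unfolding F_def
proof (induction m)
  case 0
  then show ?case using Xn G0 by (auto intro!: integrable_continuous_real continuous_intros)
next
  case (Suc m)
  have contX: "continuous_on {a..b} (X j)" if "j \<le> n" for j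
    using continuous_on_vector_derivative[of "{a..b}" "X j" "X (Suc j)"] X Xn that by (cases "j = n") auto
  let ?j = "n - Suc m"
  have j: "Suc ?j = n - m" "?j < n" "n - 1 - m = ?j" using Suc.prems by auto
  have int: "(\<lambda>t. X (n - m) t * G m t) integrable_on {a..b}"
    and IH: "integral {a..b} (\<lambda>t. X n t * G 0 t) =
      (-1) ^ m * integral {a..b} (\<lambda>t. X (n - m) t * G m t)
       + ((\<Sum>k<m. (-1) ^ k * X (n - 1 - k) b * G k b) - (\<Sum>k<m. (-1) ^ k * X (n - 1 - k) a * G k a))"
    using Suc.IH Suc.prems by auto
  have "((\<lambda>t. X (n - m) t * G m t + X ?j t * G (Suc m) t) has_integral
      (X ?j b * G m b - X ?j a * G m a)) {a..b}"
  proof (rule product_has_integral_interior[OF \<open>a \<le> b\<close>])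
    show "continuous_on {a..b} (G m)"
      using continuous_on_vector_derivative[of "{a..b}" "G m" "G (Suc m)"] Suc.prems by auto
    show "(X ?j has_vector_derivative X (n - m) t) (at t)" if "t \<in> {a<..<b}" for t
      using X[of ?j t] that j by (simp add: at_within_Icc_at)
    show "(G m has_vector_derivative G (Suc m) t) (at t)" if "t \<in> {a<..<b}" for t
      using Suc.prems(2)[of m t] that by (simp add: at_within_Icc_at)
  qed (use j contX in auto)
  \<comment> \<open>Subtracting the integrand known to be integrable by induction yields at once the
    integrability of the next one and the value of its integral.\<close>
  from has_integral_diff[OF this integrable_integral[OF int]]
  have *: "((\<lambda>t. X ?j t * G (Suc m) t) has_integral
      (X ?j b * G m b - X ?j a * G m a - integral {a..b} (\<lambda>t. X (n - m) t * G m t))) {a..b}"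
    by simp
  then have last: "integral {a..b} (\<lambda>t. X (n - m) t * G m t)
      = X ?j b * G m b - X ?j a * G m a - integral {a..b} (\<lambda>t. X ?j t * G (Suc m) t)"
    by (simp add: integral_unique)
  have "(\<lambda>t. X ?j t * G (Suc m) t) integrable_on {a..b}" using * by blast
  then show ?case unfolding IH last using j(3) by (simp add: algebra_simps)
qed

lemma integration_by_parts_order_n:
  fixes X G :: "nat \<Rightarrow> real \<Rightarrow> real"
  assumes "a < b"
    and X: "\<And>j t. j < n \<Longrightarrow> t \<in> {a..b} \<Longrightarrow> (X j has_vector_derivative X (Suc j) t) (at t within {a..b})"
    and Xn: "continuous_on {a..b} (X n)"
    and G0: "continuous_on {a..b} (G 0)"
    and G: "\<And>j t. j < n - 1 \<Longrightarrow> t \<in> {a..b} \<Longrightarrow> (G j has_vector_derivative G (Suc j) t) (at t within {a..b})"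
    and Gn: "\<And>j t. j < n \<Longrightarrow> t \<in> {a<..<b} \<Longrightarrow> (G j has_vector_derivative G (Suc j) t) (at t)"
    and int: "(\<lambda>t. X 0 t * G n t) integrable_on {a..b}"
  defines "F \<equiv> \<lambda>t. \<Sum>k<n. (-1) ^ k * X (n - 1 - k) t * G k t"
  shows "integral {a..b} (\<lambda>t. X n t * G 0 t) = (-1) ^ n * integral {a..b} (\<lambda>t. X 0 t * G n t) + (F b - F a)"
proof (cases n)
  case 0
  then show ?thesis by (simp add: F_def)
next
  case (Suc m)
  have contX: "continuous_on {a..b} (X j)" if "j \<le> n" for j
    using continuous_on_vector_derivative[of "{a..b}" "X j" "X (Suc j)"] X Xn that by (cases "j = n") auto
  have iter: "(\<lambda>t. X 1 t * G m t) integrable_on {a..b}"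
    "integral {a..b} (\<lambda>t. X n t * G 0 t) =
      (-1) ^ m * integral {a..b} (\<lambda>t. X 1 t * G m t)
       + ((\<Sum>k<m. (-1) ^ k * X (n - 1 - k) b * G k b) - (\<Sum>k<m. (-1) ^ k * X (n - 1 - k) a * G k a))"
    using iterated_integration_by_parts[of a b m n X G] assms(1) X Xn G G0 Suc by auto
  \<comment> \<open>The first summand is integrable by the preceding \<open>m\<close> steps, the
    second one by assumption.\<close>
  have sum_int: "(\<lambda>t. X 1 t * G m t + X 0 t * G n t) integrable_on {a..b}"
    by (intro integrable_add iter int)
  have "((\<lambda>t. X 1 t * G m t + X 0 t * G n t) has_integral (X 0 b * G m b - X 0 a * G m a)) {a..b}"
  \<comment> \<open>The last step sees \<open>G n\<close> in the interior only. For
    \<open>m = 0\<close> continuity of \<open>G 0\<close> closes the gap at the endpoints; otherwise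
    \<open>G m\<close> is the one-sided derivative of \<open>G (m - 1)\<close> there.\<close>
  proof (cases m)
    case 0
    show ?thesis
    proof (rule product_has_integral_interior)
      show "(X 0 has_vector_derivative X 1 t) (at t)" if "t \<in> {a<..<b}" for t
        using X[of 0 t] that Suc by (simp add: at_within_Icc_at)
      show "(G m has_vector_derivative G n t) (at t)" if "t \<in> {a<..<b}" for t
        using Gn[of m t] that Suc by simp
    qed (use G0 0 contX assms(1) in auto)
  next
    case (Suc l)
    show ?thesis
    proof (rule product_has_integral_one_sided_endpoints[OF \<open>a < b\<close> _ _ _ _ sum_int])
      show "(G l has_vector_derivative G m t) (at t within {a..b})" if "t \<in> {a..b}" for t
        using G[of l t] that Suc \<open>n = Suc m\<close> by simp
      show "(G m has_vector_derivative G n t) (at t)" if "t \<in> {a<..<b}" for t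
        using Gn[of m t] that \<open>n = Suc m\<close> by simp
      show "(X 0 has_vector_derivative X 1 t) (at t within {a..b})" if "t \<in> {a..b}" for t
        using X[of 0 t] that \<open>n = Suc m\<close> by simp
    qed (use contX \<open>n = Suc m\<close> in auto)
  qed
  then have "integral {a..b} (\<lambda>t. X 1 t * G m t) + integral {a..b} (\<lambda>t. X 0 t * G n t)
      = X 0 b * G m b - X 0 a * G m a"
    using integral_add[OF iter(1) int] by (simp add: integral_unique)
  then have last: "integral {a..b} (\<lambda>t. X 1 t * G m t)
      = X 0 b * G m b - X 0 a * G m a - integral {a..b} (\<lambda>t. X 0 t * G n t)" by linarith
  show ?thesis unfolding iter(2) last F_def by (simp add: Suc algebra_simps)
qed

section \<open>Integrals with a weakly singular kernel: Fubini's theorem and continuity\<close>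

text \<open>For a nonnegative function the Henstock-Kurzweil integral is also a Lebesgue integral.
  This power is the dominating function both for Fubini's theorem and for dominated
  convergence.\<close>

lemma has_bochner_integral_powr_from_0:
  fixes \<beta> c :: real
  assumes "\<beta> < 1" "0 \<le> c"
  shows "has_bochner_integral lborel (\<lambda>x. indicator {0<..c} x * x powr (-\<beta>)) (c powr (1 - \<beta>) / (1 - \<beta>))"
proof -
  have "((\<lambda>x. x powr (-\<beta>)) has_integral (c powr (1 - \<beta>) / (1 - \<beta>))) {0..c}"
    using has_integral_powr_from_0[of "-\<beta>" c] assms by (simp add: add.commute)
  \<comment> \<open>The two sides agree at \<open>x = 0\<close> because
    \<open>0 powr z = 0\<close>.\<close>
  moreover have "(if x \<in> {0..c} then x powr (-\<beta>) else 0) = indicator {0<..c} x * x powr (-\<beta>)" for x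
    by (auto simp: indicator_def)
  ultimately have I: "((\<lambda>x. indicator {0<..c} x * x powr (-\<beta>)) has_integral (c powr (1 - \<beta>) / (1 - \<beta>))) UNIV"
    by (simp flip: has_integral_restrict_UNIV[of "{0..c}"])
  show ?thesis
    by (rule has_bochner_integral_nn_integral)
      (use assms nn_integral_has_integral_lborel[OF _ _ I] in \<open>auto simp: indicator_def\<close>)
qed

lemma continuous_on_Icc_bounded:
  fixes u :: "real \<Rightarrow> real"
  assumes "continuous_on {a..b} u"
  obtains M where "0 \<le> M" "\<And>t. t \<in> {a..b} \<Longrightarrow> \<bar>u t\<bar> \<le> M"
proof -
  have "bounded (u ` {a..b})" by (intro compact_imp_bounded compact_continuous_image assms) auto
  then obtain M where "0 < M" "\<forall>y \<in> u ` {a..b}. norm y \<le> M" unfolding bounded_pos by blast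
  then show ?thesis by (intro that[of M]) auto
qed

text \<open>Isolates what the two convergence arguments need: continuity off the diagonal, and a
  singularity at the diagonal of order at most \<beta> < 1, hence integrable.\<close>

locale weakly_singular_kernel =
  fixes a b \<beta> B :: real and k :: "real \<Rightarrow> real \<Rightarrow> real"
  assumes \<beta>: "\<beta> < 1"
    and cont: "continuous_on {(s, r). a \<le> r \<and> r < s \<and> s \<le> b} (\<lambda>(s, r). k s r)"
    and bound: "\<And>s r. a \<le> r \<Longrightarrow> r < s \<Longrightarrow> s \<le> b \<Longrightarrow> \<bar>k s r\<bar> \<le> B * (s - r) powr (-\<beta>)"
begin

definition D :: "(real \<times> real) set" where
  "D = {(s, r). a \<le> r \<and> r < s \<and> s \<le> b}"

lemma D_measurable [measurable]: "D \<in> sets borel"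
proof -
  have "D = {p. a \<le> snd p} \<inter> {p. snd p < fst p} \<inter> {p. fst p \<le> b}" by (auto simp: D_def)
  also have "\<dots> \<in> sets borel"
    by (intro sets.Int borel_closed borel_open closed_Collect_le open_Collect_less continuous_intros)
  finally show ?thesis .
qed

lemma kernel_measurable:
  assumes "continuous_on {a..b} u" "continuous_on {a..b} v"
  shows "(\<lambda>p. indicator D p * (k (fst p) (snd p) * u (fst p) * v (snd p))) \<in> borel_measurable borel"
proof -
  have "continuous_on D (\<lambda>p. k (fst p) (snd p) * u (fst p) * v (snd p))"
    using cont assms
    by (intro continuous_intros continuous_on_compose2[OF assms(1)] continuous_on_compose2[OF assms(2)])
      (auto simp: D_def case_prod_beta)
  from borel_measurable_continuous_on_indicator[OF D_measurable this] show ?thesis by simp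
qed

lemma B_nonneg: "a < b \<Longrightarrow> 0 \<le> B"
  using bound[of a b] by (smt (verit) powr_gt_zero zero_le_mult_iff)

text \<open>This is Dirichlet's exchange of integrals over a triangle. Extended by zero to the
  plane, the integrand is dominated by an integrable function of \<open>t - \<tau>\<close> alone,
  which makes it absolutely integrable.\<close>

lemma swap_integrals:
  assumes "a < b" and u: "continuous_on {a..b} u" and v: "continuous_on {a..b} v"
  shows "integral {a..b} (\<lambda>t. u t * integral {a..t} (\<lambda>\<tau>. k t \<tau> * v \<tau>))
       = integral {a..b} (\<lambda>\<tau>. v \<tau> * integral {\<tau>..b} (\<lambda>t. k t \<tau> * u t))"
proof -
  define f where "f = (\<lambda>t \<tau>. indicator D (t, \<tau>) * (k t \<tau> * u t * v \<tau>))"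
  obtain Mu where Mu: "0 \<le> Mu" "\<And>t. t \<in> {a..b} \<Longrightarrow> \<bar>u t\<bar> \<le> Mu" using continuous_on_Icc_bounded[OF u] by blast
  obtain Mv where Mv: "0 \<le> Mv" "\<And>t. t \<in> {a..b} \<Longrightarrow> \<bar>v t\<bar> \<le> Mv" using continuous_on_Icc_bounded[OF v] by blast
  define p where "p = (\<lambda>x. indicator {0<..b - a} x * x powr (-\<beta>))"
  define M where "M = B * Mu * Mv"
  have M: "0 \<le> M" using Mu Mv B_nonneg \<open>a < b\<close> by (simp add: M_def)
  have p: "integrable lborel p" and p0: "p x \<ge> 0" for x
    using has_bochner_integral_powr_from_0[OF \<beta>, of "b - a"] \<open>a < b\<close> unfolding p_def
    by (auto simp: has_bochner_integral_iff)
  have f_borel: "case_prod f \<in> borel_measurable (lborel \<Otimes>\<^sub>M lborel)"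
    using kernel_measurable[OF u v] unfolding lborel_prod f_def by (simp add: case_prod_unfold)
  have [measurable]: "case_prod f \<in> borel_measurable (borel \<Otimes>\<^sub>M borel)"
    using f_borel by (simp cong: measurable_cong_sets)
  have f_bound: "norm (f t \<tau>) \<le> M * p (t - \<tau>)" for t \<tau>
  proof (cases "(t, \<tau>) \<in> D")
    case True
    then have "\<bar>k t \<tau> * u t * v \<tau>\<bar> \<le> B * (t - \<tau>) powr (-\<beta>) * Mu * Mv"
      unfolding abs_mult using bound[of \<tau> t] Mu Mv
      by (intro mult_mono) (auto simp: D_def)
    then show ?thesis using True by (auto simp: f_def p_def M_def D_def mult_ac)
  qed (use M p0 in \<open>auto simp: f_def\<close>)
  \<comment> \<open>Both kinds of sections are dominated by multiples of affine images of
    \<open>p\<close>: a reflected translate in \<tau>, a translate in \<open>t\<close>.\<close>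
  have sec1: "integrable lborel (\<lambda>\<tau>. f t \<tau>)" for t
    by (rule Bochner_Integration.integrable_bound[where f = "\<lambda>\<tau>. M * p (t + (-1) * \<tau>)"])
      (use f_bound M p0 lborel_integrable_real_affine[OF p, of "-1" t] in auto)
  have sec2: "integrable lborel (\<lambda>t. f t \<tau>)" for \<tau>
    by (rule Bochner_Integration.integrable_bound[where f = "\<lambda>t. M * p (- \<tau> + 1 * t)"])
      (use f_bound M p0 lborel_integrable_real_affine[OF p, of 1 "-\<tau>"] in auto)
  have "integrable (lborel \<Otimes>\<^sub>M lborel) (case_prod f)"
  proof (rule lborel_pair.Fubini_integrable[OF f_borel])
    \<comment> \<open>Invariance of Lebesgue measure under reflection and translation makes this
      bound independent of \<open>t\<close>. Since the left side vanishes outside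
      \<open>{a..b}\<close>, it is then dominated by a multiple of an indicator.\<close>
    have "(\<integral>\<tau>. norm (f t \<tau>) \<partial>lborel) \<le> M * (\<integral>x. p x \<partial>lborel)" for t
    proof -
      have "(\<integral>\<tau>. norm (f t \<tau>) \<partial>lborel) \<le> (\<integral>\<tau>. M * p (t + (-1) * \<tau>) \<partial>lborel)"
        by (intro integral_mono integrable_norm sec1 integrable_mult_right lborel_integrable_real_affine[OF p])
          (use f_bound in auto)
      also have "\<dots> = M * (\<integral>x. p x \<partial>lborel)"
        using lborel_integral_real_affine[of "-1" p t] by simp
      finally show ?thesis .
    qed
    moreover have "(\<integral>\<tau>. norm (f t \<tau>) \<partial>lborel) = 0" if "t \<notin> {a..b}" for t
      using that by (intro integral_eq_zero_AE) (auto simp: f_def D_def indicator_def)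
    ultimately have le: "norm (\<integral>\<tau>. norm (f t \<tau>) \<partial>lborel)
        \<le> norm (indicator {a..b} t * (M * (\<integral>x. p x \<partial>lborel)))" for t
      by (cases "t \<in> {a..b}") (auto intro: order_trans[OF _ abs_ge_self])
    have "integrable lborel (\<lambda>t. indicator {a..b} t * (M * (\<integral>x. p x \<partial>lborel)))"
      by (intro integrable_mult_left integrable_real_indicator) (auto simp: \<open>a < b\<close> less_imp_le)
    then have "integrable lborel (\<lambda>t. \<integral>\<tau>. norm (f t \<tau>) \<partial>lborel)"
      by (rule Bochner_Integration.integrable_bound[OF _ _ AE_I2[OF le]]) measurable
    then show "integrable lborel (\<lambda>x. \<integral>y. norm (case_prod f (x, y)) \<partial>lborel)"
      by simp
  qed (use sec1 in auto)
  note f_int = this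
  have inner1: "(\<integral>\<tau>. f t \<tau> \<partial>lborel) = indicator {a..b} t * (u t * integral {a..t} (\<lambda>\<tau>. k t \<tau> * v \<tau>))" for t
  proof (cases "t \<in> {a..b}")
    case True
    \<comment> \<open>\<open>D\<close> omits the diagonal, so the section lives on a half-open
      interval; the missing point is negligible.\<close>
    have eq: "f t \<tau> = indicator {a..<t} \<tau> *\<^sub>R (u t * (k t \<tau> * v \<tau>))" for \<tau>
      using True by (auto simp: f_def D_def indicator_def)
    have "(\<integral>\<tau>. f t \<tau> \<partial>lborel) = integral {a..<t} (\<lambda>\<tau>. u t * (k t \<tau> * v \<tau>))"
      using set_borel_integral_eq_integral(2)[of "{a..<t}" "\<lambda>\<tau>. u t * (k t \<tau> * v \<tau>)"] sec1[of t]
      unfolding set_integrable_def set_lebesgue_integral_def eq by simp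
    also have "\<dots> = integral {a..t} (\<lambda>\<tau>. u t * (k t \<tau> * v \<tau>))"
      by (rule integral_subset_negligible) (auto intro: negligible_subset[of "{t}"])
    finally show ?thesis using True by simp
  next
    case False
    then have "f t \<tau> = 0" for \<tau> by (auto simp: f_def D_def)
    with False show ?thesis by simp
  qed
  have inner2: "(\<integral>t. f t \<tau> \<partial>lborel) = indicator {a..b} \<tau> * (v \<tau> * integral {\<tau>..b} (\<lambda>t. k t \<tau> * u t))" for \<tau>
  proof (cases "\<tau> \<in> {a..b}")
    case True
    have eq: "f t \<tau> = indicator {\<tau><..b} t *\<^sub>R (v \<tau> * (k t \<tau> * u t))" for t
      using True by (auto simp: f_def D_def indicator_def)
    have "(\<integral>t. f t \<tau> \<partial>lborel) = integral {\<tau><..b} (\<lambda>t. v \<tau> * (k t \<tau> * u t))"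
      using set_borel_integral_eq_integral(2)[of "{\<tau><..b}" "\<lambda>t. v \<tau> * (k t \<tau> * u t)"] sec2[of \<tau>]
      unfolding set_integrable_def set_lebesgue_integral_def eq by simp
    also have "\<dots> = integral {\<tau>..b} (\<lambda>t. v \<tau> * (k t \<tau> * u t))"
      by (rule integral_subset_negligible) (auto intro: negligible_subset[of "{\<tau>}"])
    finally show ?thesis using True by simp
  next
    case False
    then have "f t \<tau> = 0" for t by (auto simp: f_def D_def)
    with False show ?thesis by simp
  qed
  have out: "(\<integral>t. indicator {a..b} t * g t \<partial>lborel) = integral {a..b} g"
    if "integrable lborel (\<lambda>t. indicator {a..b} t * g t)" for g :: "real \<Rightarrow> real"
    using set_borel_integral_eq_integral(2)[of "{a..b}" g] that
    unfolding set_integrable_def set_lebesgue_integral_def by simp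
  have "(\<integral>\<tau>. (\<integral>t. f t \<tau> \<partial>lborel) \<partial>lborel) = (\<integral>t. (\<integral>\<tau>. f t \<tau> \<partial>lborel) \<partial>lborel)"
    by (rule lborel_pair.Fubini_integral[OF f_int])
  \<comment> \<open>This integrability is what allows the outer Lebesgue integrals to be read as
    Henstock-Kurzweil integrals.\<close>
  moreover have "integrable lborel (\<lambda>t. \<integral>\<tau>. f t \<tau> \<partial>lborel)" "integrable lborel (\<lambda>\<tau>. \<integral>t. f t \<tau> \<partial>lborel)"
    using lborel_pair.integrable_fst[OF f_int] lborel_pair.integrable_snd[OF f_int] by auto
  ultimately show ?thesis unfolding inner1 inner2 by (simp add: out)
qed

text \<open>Substituting \<open>t + s\<close> for the integration variable fixes the singularity at
  \<open>s = 0\<close>. The integrands then share one dominating function for all \<open>t\<close>,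
  and dominated convergence applies along sequences.\<close>

lemma continuous_on_right_integral:
  assumes u: "continuous_on {a..b} u"
  shows "continuous_on {a..b} (\<lambda>t. integral {t..b} (\<lambda>s. k s t * u s))"
proof (cases "a < b")
  case True
  obtain Mu where Mu: "0 \<le> Mu" "\<And>t. t \<in> {a..b} \<Longrightarrow> \<bar>u t\<bar> \<le> Mu" using continuous_on_Icc_bounded[OF u] by blast
  define p where "p = (\<lambda>x. indicator {0<..b - a} x * x powr (-\<beta>))"
  have p: "integrable lborel p"
    using has_bochner_integral_powr_from_0[OF \<beta>, of "b - a"] True unfolding p_def
    by (auto simp: has_bochner_integral_iff)
  have p0: "p x \<ge> 0" for x by (simp add: p_def)
  define f where "f = (\<lambda>t s. indicator D (t + s, t) * (k (t + s) t * u (t + s)))"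
  have f_meas [measurable]: "f t \<in> borel_measurable lborel" for t
  proof -
    have "(\<lambda>s. (t + s, t)) \<in> borel_measurable borel" by measurable
    from measurable_compose[OF this kernel_measurable[OF u continuous_on_const[of _ 1]]]
    show ?thesis by (simp add: f_def)
  qed
  have f_bound: "norm (f t s) \<le> B * Mu * p s" for t s
  proof (cases "(t + s, t) \<in> D")
    case True
    then have "\<bar>k (t + s) t * u (t + s)\<bar> \<le> B * s powr (-\<beta>) * Mu"
      unfolding abs_mult using bound[of t "t + s"] Mu
      by (intro mult_mono) (auto simp: D_def)
    then show ?thesis using True by (auto simp: f_def p_def D_def mult_ac)
  qed (use p0 Mu(1) B_nonneg[OF True] in \<open>simp add: f_def\<close>)
  have f_int: "integrable lborel (f t)" for t
  proof (rule Bochner_Integration.integrable_bound[OF _ f_meas])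
    show "integrable lborel (\<lambda>s. B * Mu * p s)" using p by simp
    show "AE s in lborel. norm (f t s) \<le> norm (B * Mu * p s)"
      using f_bound by (intro AE_I2) (metis abs_ge_self order_trans real_norm_def)
  qed
  have eq: "integral {t..b} (\<lambda>s. k s t * u s) = (\<integral>s. f t s \<partial>lborel)" if t: "t \<in> {a..b}" for t
  proof -
    have eqf: "f t (-t + 1 * s) = indicator {t<..b} s *\<^sub>R (k s t * u s)" for s
      using t by (auto simp: f_def D_def indicator_def)
    have "integrable lborel (\<lambda>s. f t (-t + 1 * s))"
      by (intro lborel_integrable_real_affine f_int) auto
    then have "(\<integral>s. f t (-t + 1 * s) \<partial>lborel) = integral {t<..b} (\<lambda>s. k s t * u s)"
      using set_borel_integral_eq_integral(2)[of "{t<..b}" "\<lambda>s. k s t * u s"]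
      unfolding set_integrable_def set_lebesgue_integral_def eqf by simp
    also have "\<dots> = integral {t..b} (\<lambda>s. k s t * u s)"
      by (rule integral_subset_negligible) (auto intro: negligible_subset[of "{t}"])
    finally show ?thesis using lborel_integral_real_affine[of 1 "f t" "-t"] by simp
  qed
  have "continuous_on {a..b} (\<lambda>t. \<integral>s. f t s \<partial>lborel)"
    unfolding continuous_on_sequentially
  proof (intro allI ballI impI, elim conjE)
    fix X t assume t: "t \<in> {a..b}" and X: "\<forall>n. X n \<in> {a..b}" "X \<longlonglongrightarrow> t"
    \<comment> \<open>At \<open>s = b - t\<close> the point \<open>(t + s, t)\<close> lies on the
      edge of \<open>D\<close>, and nearby points may fall outside, so the limit can fail there.
      This is a single point and thus a null set.\<close>
    have lim: "(\<lambda>n. f (X n) s) \<longlonglongrightarrow> f t s" if s: "s \<noteq> b - t" for s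
    proof (cases "(t + s, t) \<in> D")
      case True
      then have "t + s < b" "s > 0" using s by (auto simp: D_def)
      have "eventually (\<lambda>n. X n + s < b) sequentially"
        by (rule order_tendstoD[OF _ \<open>t + s < b\<close>]) (intro tendsto_intros X)
      then have ev: "eventually (\<lambda>n. (X n + s, X n) \<in> D) sequentially"
        by eventually_elim (use X \<open>s > 0\<close> in \<open>auto simp: D_def\<close>)
      have contD: "continuous_on D (\<lambda>p. k (fst p) (snd p) * u (fst p))"
        using cont
        by (intro continuous_intros continuous_on_compose2[OF u]) (auto simp: D_def case_prod_beta)
      have "(\<lambda>n. (X n + s, X n)) \<longlonglongrightarrow> (t + s, t)" by (intro tendsto_intros X)
      from continuous_on_tendsto_compose[OF contD this True ev]
      have "(\<lambda>n. k (X n + s) (X n) * u (X n + s)) \<longlonglongrightarrow> k (t + s) t * u (t + s)"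
        by (simp only: fst_conv snd_conv)
      moreover have "eventually (\<lambda>n. f (X n) s = k (X n + s) (X n) * u (X n + s)) sequentially"
        using ev by eventually_elim (simp add: f_def)
      moreover have "f t s = k (t + s) t * u (t + s)" using True by (simp add: f_def)
      ultimately show ?thesis by (simp only: tendsto_cong)
    next
      case False
      have "eventually (\<lambda>n. (X n + s, X n) \<notin> D) sequentially"
      proof (cases "s > 0")
        case True
        with False t s have "b < t + s" by (auto simp: D_def)
        have "eventually (\<lambda>n. b < X n + s) sequentially"
          by (rule order_tendstoD[OF _ \<open>b < t + s\<close>]) (intro tendsto_intros X)
        then show ?thesis by eventually_elim (auto simp: D_def)
      qed (auto simp: D_def)
      then have "eventually (\<lambda>n. f (X n) s = 0) sequentially"
        by eventually_elim (simp add: f_def)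
      then show ?thesis using False by (simp add: f_def tendsto_eventually)
    qed
    have AE_lim: "AE s in lborel. (\<lambda>n. f (X n) s) \<longlonglongrightarrow> f t s"
      by (rule AE_mp[OF AE_lborel_singleton[of "b - t"] AE_I2]) (blast intro: lim)
    have "(\<lambda>n. \<integral>s. f (X n) s \<partial>lborel) \<longlonglongrightarrow> (\<integral>s. f t s \<partial>lborel)"
      by (rule integral_dominated_convergence[OF _ _ _ AE_lim, where w = "\<lambda>s. B * Mu * p s"])
        (use f_bound p in auto)
    then show "((\<lambda>t. \<integral>s. f t s \<partial>lborel) \<circ> X) \<longlonglongrightarrow> (\<integral>s. f t s \<partial>lborel)"
      by (simp add: o_def)
  qed
  then show ?thesis by (rule continuous_on_eq) (simp add: eq)
next
  case False
  then consider "a = b" | "b < a" by linarith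
  then show ?thesis by cases simp_all
qed

end

text \<open>The reflection taking \<open>(s, r)\<close> to \<open>(-r, -s)\<close> preserves
  \<open>s - r\<close> and turns left integrals into right ones, so the previous result applies to
  the reflected kernel.\<close>

lemma (in weakly_singular_kernel) continuous_on_left_integral:
  assumes u: "continuous_on {a..b} u"
  shows "continuous_on {a..b} (\<lambda>t. integral {a..t} (\<lambda>r. k t r * u r))"
proof -
  interpret refl: weakly_singular_kernel "-b" "-a" \<beta> B "\<lambda>s r. k (-r) (-s)"
  proof
    show "continuous_on {(s, r). - b \<le> r \<and> r < s \<and> s \<le> - a} (\<lambda>(s, r). k (- r) (- s))"
      using continuous_on_compose2[OF cont, of "{(s, r). - b \<le> r \<and> r < s \<and> s \<le> - a}" "\<lambda>(s, r). (-r, -s)"]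
      by (force simp: case_prod_beta intro!: continuous_intros)
    show "\<bar>k (- r) (- s)\<bar> \<le> B * (s - r) powr - \<beta>" if "- b \<le> r" "r < s" "s \<le> - a" for s r
      using bound[of "-s" "-r"] that by simp
  qed (rule \<beta>)
  have "continuous_on {-b..-a} (\<lambda>t. u (-t))"
    by (intro continuous_on_compose2[OF u] continuous_intros) auto
  then have "continuous_on {-b..-a} (\<lambda>t. integral {t..-a} (\<lambda>s. k (-t) (-s) * u (-s)))"
    by (rule refl.continuous_on_right_integral)
  then have "continuous_on {a..b} (\<lambda>t. integral {-t..-a} (\<lambda>s. k (- (-t)) (-s) * u (-s)))"
    by (rule continuous_on_compose2) (auto intro!: continuous_intros)
  then show ?thesis using Henstock_Kurzweil_Integration.integral_reflect_real[of _ a "\<lambda>r. k _ r * u r"] by simp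
qed

section \<open>Weak singularity of the variable-order fractional kernel\<close>

text \<open>By compactness \<alpha> attains its maximum, which is therefore strictly below
  \<open>n\<close>. This bounds the order of the singularity uniformly away from 1.\<close>

lemma weakly_singular_frac_kernel:
  assumes "a < b"
    and cont: "continuous_on ({a..b} \<times> {a..b}) (\<lambda>(t, \<tau>). \<alpha> t \<tau>)"
    and range: "\<forall>t\<in>{a..b}. \<forall>\<tau>\<in>{a..b}. \<alpha> t \<tau> \<in> {real n - 1<..<real n}"
  obtains \<beta> B where "weakly_singular_kernel a b \<beta> B (frac_kernel n \<alpha>)"
proof -
  let ?S = "{a..b} \<times> {a..b}"
  let ?\<alpha> = "\<lambda>p. \<alpha> (fst p) (snd p)"
  have cont\<alpha>: "continuous_on ?S ?\<alpha>" using cont by (simp add: case_prod_beta)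
  have S: "compact ?S" "?S \<noteq> {}" using \<open>a < b\<close> by (auto intro: compact_Times)
  obtain q where q: "q \<in> ?S" "\<And>p. p \<in> ?S \<Longrightarrow> ?\<alpha> p \<le> ?\<alpha> q"
    using continuous_attains_sup[OF S cont\<alpha>] by auto
  define \<beta> where "\<beta> = ?\<alpha> q - real n + 1"
  have "?\<alpha> p \<in> {real n - 1<..<real n}" if "p \<in> ?S" for p using that range by auto
  then have rng: "real n - 1 < ?\<alpha> p" "?\<alpha> p < real n" if "p \<in> ?S" for p using that by auto
  have Gamma_ne: "Gamma (real n - ?\<alpha> p) \<noteq> 0" if "p \<in> ?S" for p
    using rng[OF that] Gamma_real_pos[of "real n - ?\<alpha> p"] by linarith
  have cont_Gamma: "continuous_on ?S (\<lambda>p. Gamma (real n - ?\<alpha> p))"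
  proof (rule continuous_on_compose2[OF continuous_on_Gamma])
    show "continuous_on ?S (\<lambda>p. real n - ?\<alpha> p)" by (intro continuous_intros cont\<alpha>)
    show "(\<lambda>p. real n - ?\<alpha> p) ` ?S \<subseteq> {0<..}" using rng by fastforce
  qed (auto elim: nonpos_Ints_cases)
  \<comment> \<open>The argument of \<open>Gamma\<close> stays positive on the compact square, so
    the reciprocal is continuous and bounded.\<close>
  have "bounded ((\<lambda>p. 1 / Gamma (real n - ?\<alpha> p)) ` ?S)"
    by (intro compact_imp_bounded compact_continuous_image S continuous_intros cont_Gamma)
      (use Gamma_ne in auto)
  then obtain C where C: "0 < C" "\<And>p. p \<in> ?S \<Longrightarrow> \<bar>1 / Gamma (real n - ?\<alpha> p)\<bar> \<le> C"
    unfolding bounded_pos by auto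
  have "weakly_singular_kernel a b \<beta> ((1 + (b - a)) * C) (frac_kernel n \<alpha>)"
  proof
    show "\<beta> < 1" using rng[OF q(1)] by (simp add: \<beta>_def)
    let ?D = "{(s, r). a \<le> r \<and> r < s \<and> s \<le> b}"
    have D: "?D \<subseteq> ?S" by auto
    have "continuous_on ?D (\<lambda>p. (fst p - snd p) powr (real n - 1 - ?\<alpha> p) / Gamma (real n - ?\<alpha> p))"
      using Gamma_ne
      by (intro continuous_intros continuous_on_subset[OF cont\<alpha> D] continuous_on_subset[OF cont_Gamma D]) auto
    then show "continuous_on ?D (\<lambda>(s, r). frac_kernel n \<alpha> s r)"
      by (simp add: frac_kernel_def case_prod_beta)
    fix s r assume sr: "a \<le> r" "r < s" "s \<le> b"
    then have p: "(s, r) \<in> ?S" by auto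
    have e: "- \<beta> \<le> real n - 1 - \<alpha> s r" "real n - 1 - \<alpha> s r < 0" "-\<beta> > -1"
      using q(2)[OF p] rng[OF p] rng[OF q(1)] by (auto simp: \<beta>_def)
    \<comment> \<open>\<open>d\<close> is the excess of the actual exponent over the worst one. As
      it lies between 0 and 1, raising the base to \<open>1 + (b - a)\<close>, which is at least 1,
      and then the exponent to 1 gives a bound free of \<open>d\<close>.\<close>
    define d where "d = real n - 1 - \<alpha> s r + \<beta>"
    have d: "0 \<le> d" "d \<le> 1" using e by (auto simp: d_def)
    have "(s - r) powr (real n - 1 - \<alpha> s r) = (s - r) powr d * (s - r) powr (-\<beta>)"
      by (simp add: powr_add[symmetric] d_def)
    also have "(s - r) powr d \<le> (1 + (b - a)) powr d"
      using sr d by (intro powr_mono2) auto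
    also have "\<dots> \<le> (1 + (b - a)) powr 1"
      using sr d by (intro powr_mono) auto
    also have "\<dots> = 1 + (b - a)" using sr by simp
    finally have powr_le: "(s - r) powr (real n - 1 - \<alpha> s r) \<le> (1 + (b - a)) * (s - r) powr (-\<beta>)"
      by (simp add: mult_right_mono)
    have "\<bar>frac_kernel n \<alpha> s r\<bar> = (s - r) powr (real n - 1 - \<alpha> s r) * \<bar>1 / Gamma (real n - \<alpha> s r)\<bar>"
      by (simp add: frac_kernel_def abs_mult)
    also have "\<dots> \<le> ((1 + (b - a)) * (s - r) powr (-\<beta>)) * C"
      using powr_le C(2)[OF p] sr by (intro mult_mono) auto
    finally show "\<bar>frac_kernel n \<alpha> s r\<bar> \<le> (1 + (b - a)) * C * (s - r) powr - \<beta>"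
      by (simp add: mult_ac)
  qed
  then show ?thesis by (rule that)
qed

section \<open>Iterated derivatives within an interval and the final formulas\<close>

lemma nderiv_on_0 [simp]: "nderiv_on S 0 f = f"
  by (simp add: nderiv_on_def)

lemma has_vector_derivative_nderiv_on:
  assumes "n_times_differentiable_on n f S T" "j < n" "t \<in> T"
  shows "(nderiv_on S j f has_vector_derivative nderiv_on S (Suc j) f t) (at t within S)"
proof -
  have "nderiv_on S j f differentiable (at t within S)"
    using assms by (simp add: n_times_differentiable_on_def)
  moreover have "nderiv_on S (Suc j) f t = vector_derivative (nderiv_on S j f) (at t within S)"
    by (simp add: nderiv_on_def)
  ultimately show ?thesis by (simp only: vector_derivative_works)
qed

lemma C_n_on_imp_continuous_on:
  assumes "C_n_on n f S"
  shows "continuous_on S f"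
proof (cases "n = 0")
  case False
  then have "(f has_vector_derivative nderiv_on S 1 f t) (at t within S)" if "t \<in> S" for t
    using assms has_vector_derivative_nderiv_on[of n f S S 0 t] that by (simp add: C_n_on_def)
  then show ?thesis by (rule continuous_on_vector_derivative)
qed (use assms in \<open>simp add: C_n_on_def\<close>)

lemma nderiv_integration_by_parts:
  assumes "a < b" and x: "C_n_on n x {a..b}" and g: "continuous_on {a..b} g"
    and def: "by_parts_defined a b n x g"
  shows "integral {a..b} (\<lambda>t. nderiv_on {a..b} n x t * g t) =
      (-1) ^ n * integral {a..b} (\<lambda>t. x t * nderiv_on {a..b} n g t)
      + ((\<Sum>k<n. (-1) ^ k * nderiv_on {a..b} (n - 1 - k) x b * nderiv_on {a..b} k g b)
       - (\<Sum>k<n. (-1) ^ k * nderiv_on {a..b} (n - 1 - k) x a * nderiv_on {a..b} k g a))"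
proof -
  let ?X = "\<lambda>j. nderiv_on {a..b} j x" and ?G = "\<lambda>j. nderiv_on {a..b} j g"
  \<comment> \<open>At an interior point the derivative within \<open>{a..b}\<close> is the ordinary
    two-sided one.\<close>
  have "(?G j has_vector_derivative ?G (Suc j) t) (at t)" if "j < n" "t \<in> {a<..<b}" for j t
    using has_vector_derivative_nderiv_on[of n g "{a..b}" "{a<..<b}" j t] def that
    by (simp add: by_parts_defined_def at_within_Icc_at)
  moreover have "(?X j has_vector_derivative ?X (Suc j) t) (at t within {a..b})"
    if "j < n" "t \<in> {a..b}" for j t
    using x that by (intro has_vector_derivative_nderiv_on[of n]) (auto simp: C_n_on_def)
  moreover have "(?G j has_vector_derivative ?G (Suc j) t) (at t within {a..b})"
    if "j < n - 1" "t \<in> {a..b}" for j t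
    using def that by (intro has_vector_derivative_nderiv_on[of "n - 1"]) (auto simp: by_parts_defined_def)
  moreover have "continuous_on {a..b} (?X n)" "continuous_on {a..b} (?G 0)"
      "(\<lambda>t. ?X 0 t * ?G n t) integrable_on {a..b}"
    using x g def by (auto simp: C_n_on_def by_parts_defined_def)
  ultimately have "integral {a..b} (\<lambda>t. ?X n t * ?G 0 t) = (-1) ^ n * integral {a..b} (\<lambda>t. ?X 0 t * ?G n t)
      + ((\<Sum>k<n. (-1) ^ k * ?X (n - 1 - k) b * ?G k b) - (\<Sum>k<n. (-1) ^ k * ?X (n - 1 - k) a * ?G k a))"
    using integration_by_parts_order_n[of a b n ?X ?G] \<open>a < b\<close> by blast
  then show ?thesis by simp
qed

theorem theorem2p7:
  fixes n :: nat and a b :: real and \<alpha> :: "real \<Rightarrow> real \<Rightarrow> real" and x y :: "real \<Rightarrow> real"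
  assumes "a < b"
    and "continuous_on ({a..b} \<times> {a..b}) (\<lambda>(t, \<tau>). \<alpha> t \<tau>)"
    and "\<forall>t\<in>{a..b}. \<forall>\<tau>\<in>{a..b}. \<alpha> t \<tau> \<in> {real n - 1<..<real n}"
    and "C_n_on n x {a..b}" and "C_n_on n y {a..b}"
  shows
    "(by_parts_defined a b n x (RL_int_right b n \<alpha> y) \<longrightarrow>
       (let F = (\<lambda>t. \<Sum>k<n. (-1) ^ k * nderiv_on {a..b} (n - 1 - k) x t
                        * nderiv_on {a..b} k (RL_int_right b n \<alpha> y) t)
        in integral {a..b} (\<lambda>t. y t * Caputo_deriv_left a b n \<alpha> x t)
             = integral {a..b} (\<lambda>t. x t * RL_deriv_right a b n \<alpha> y t) + (F b - F a))) \<and>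
     (by_parts_defined a b n x (RL_int_left a n \<alpha> y) \<longrightarrow>
       (let F = (\<lambda>t. \<Sum>k<n. (-1) ^ (n + k) * nderiv_on {a..b} (n - 1 - k) x t
                        * nderiv_on {a..b} k (RL_int_left a n \<alpha> y) t)
        in integral {a..b} (\<lambda>t. y t * Caputo_deriv_right a b n \<alpha> x t)
             = integral {a..b} (\<lambda>t. x t * RL_deriv_left a b n \<alpha> y t) + (F b - F a)))"
proof -
  obtain \<beta> B where "weakly_singular_kernel a b \<beta> B (frac_kernel n \<alpha>)"
    by (rule weakly_singular_frac_kernel[OF assms(1-3)])
  then interpret weakly_singular_kernel a b \<beta> B "frac_kernel n \<alpha>" .
  let ?xn = "nderiv_on {a..b} n x" and ?g = "RL_int_right b n \<alpha> y" and ?h = "RL_int_left a n \<alpha> y"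
  have xn: "continuous_on {a..b} ?xn" using assms(4) by (simp add: C_n_on_def)
  have y: "continuous_on {a..b} y" using assms(5) by (rule C_n_on_imp_continuous_on)
  have g: "continuous_on {a..b} ?g" and h: "continuous_on {a..b} ?h"
    using continuous_on_right_integral[OF y] continuous_on_left_integral[OF y]
    unfolding RL_int_right_def[abs_def] RL_int_left_def[abs_def] .
  have left: "integral {a..b} (\<lambda>t. y t * Caputo_deriv_left a b n \<alpha> x t) = integral {a..b} (\<lambda>t. ?xn t * ?g t)"
    using swap_integrals[OF assms(1) y xn] by (simp add: Caputo_deriv_left_def RL_int_right_def)
  have "x t * RL_deriv_right a b n \<alpha> y t = (-1) ^ n * (x t * nderiv_on {a..b} n ?g t)" for t
    by (simp add: RL_deriv_right_def)
  \<comment> \<open>The factor may be pulled out before anything is known about integrability, since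
    an integral that does not exist has the value 0.\<close>
  then have right_deriv: "integral {a..b} (\<lambda>t. x t * RL_deriv_right a b n \<alpha> y t)
      = (-1) ^ n * integral {a..b} (\<lambda>t. x t * nderiv_on {a..b} n ?g t)"
    by (simp only: integral_mult_right)
  have "y t * Caputo_deriv_right a b n \<alpha> x t
      = (-1) ^ n * (y t * integral {t..b} (\<lambda>\<tau>. frac_kernel n \<alpha> \<tau> t * ?xn \<tau>))" for t
    by (simp add: Caputo_deriv_right_def)
  \<comment> \<open>Here the exchange of integrals is read from right to left, with \<open>y\<close>
    and the derivative of \<open>x\<close> in swapped roles.\<close>
  then have right: "integral {a..b} (\<lambda>t. y t * Caputo_deriv_right a b n \<alpha> x t)
      = (-1) ^ n * integral {a..b} (\<lambda>t. ?xn t * ?h t)"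
    unfolding RL_int_left_def swap_integrals[OF assms(1) xn y] by (simp only: integral_mult_right)
  have sign: "(-1 :: real) ^ n * ((-1) ^ n * r) = r" for r
    by (cases "even n") simp_all
  have sum_sign: "(\<Sum>k<n. (-1) ^ (n + k) * X k * G k) = (-1) ^ n * (\<Sum>k<n. (-1) ^ k * X k * G k)"
    for X G :: "nat \<Rightarrow> real"
    by (simp only: sum_distrib_left power_add mult.assoc)
  show ?thesis
    unfolding Let_def left right right_deriv RL_deriv_left_def sum_sign
    \<comment> \<open>The first formula is integration by parts as it stands. For the second, the
      identity is multiplied by \<open>(-1) ^ n\<close>: the sign before the integral cancels, and
      the boundary sum acquires \<open>(-1) ^ (n + k)\<close>.\<close>
    using nderiv_integration_by_parts[OF assms(1,4) g]
      arg_cong[OF nderiv_integration_by_parts[OF assms(1,4) h], of "(*) ((-1) ^ n)"]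
    unfolding distrib_left right_diff_distrib sign by blast
qed

end
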